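(* Let $n\ge 1$ and $x=(x_1,\dots,x_n)\in\mathbb{N}^n$. Let $P_n(x)$ denote the number of $x$-parking functions and $\mathrm{park}(n)$ the set of parking functions of length $n$. Then $$P_n(x)=\sum_{(a_1,\dots,a_n)\in\mathrm{park}(n)}x_{a_1}\cdots x_{a_n}=n!\,V_n(x).$$
   Context: $\mathbb N=\{0,1,2,\dots\}$. A parking function of length $n$ is a sequence $(a_1,\dots,a_n)$ of positive integers whose increasing rearrangement $b_1\le\cdots\le b_n$ satisfies $b_i\le i$ for all $i$. An $x$-parking function is a sequence $(a_1,\dots,a_n)$ of positive integers whose increasing rearrangement $b_1\le\cdots\le b_n$ satisfies $b_i\le x_1+\cdots+x_i$ for all $i$. $V_n$ is the volume polynomial: for $x_i>0$, $V_n(x)$ is the $n$-dimensional volume of $\Pi_n(x)=\{y\in\mathbb{R}^n: y_i\ge 0,\ y_1+\cdots+y_i\le x_1+\cdots+x_i \text{ for all } 1\le i\le n\}$; this is a homogeneous polynomial of degree $n$ in $x_1,\dots,x_n$, evaluated as a polynomial for nonnegative $x$ (where it still equals the volume). *)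

theory Defs
  imports "HOL-Analysis.Analysis"
begin

text \<open>A sequence \<open>(a\<^sub>1, \<dots>, a\<^sub>n)\<close> is a list of length \<open>n\<close>; its increasing rearrangement is
  \<open>sort a\<close>, so the 1-based entry \<open>b\<^sub>i\<close> is \<open>sort a ! (i - 1)\<close>. A vector \<open>(x\<^sub>1, \<dots>, x\<^sub>n)\<close> is
  a function on \<open>nat\<close> of which only the values at \<open>1, \<dots>, n\<close> are used.\<close>

definition park :: "nat \<Rightarrow> nat list set" where
  "park n = {a. length a = n \<and> (\<forall>k\<in>set a. k > 0) \<and> (\<forall>i\<in>{1..n}. sort a ! (i - 1) \<le> i)}"

definition x_park :: "nat \<Rightarrow> (nat \<Rightarrow> nat) \<Rightarrow> nat list set" where
  "x_park n x = {a. length a = n \<and> (\<forall>k\<in>set a. k > 0) \<and>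
     (\<forall>i\<in>{1..n}. sort a ! (i - 1) \<le> (\<Sum>j=1..i. x j))}"

text \<open>Points of \<open>\<real>\<^sup>n\<close> are functions that are extensional on \<open>{1..n}\<close>, as in the product measure
  \<open>PiM {1..n} (\<lambda>_. lborel)\<close>, which plays the role of \<open>n\<close>-dimensional Lebesgue measure.\<close>

definition Pi_polytope :: "nat \<Rightarrow> (nat \<Rightarrow> real) \<Rightarrow> (nat \<Rightarrow> real) set" where
  "Pi_polytope n x = {y \<in> extensional {1..n}.
     \<forall>i\<in>{1..n}. 0 \<le> y i \<and> (\<Sum>j=1..i. y j) \<le> (\<Sum>j=1..i. x j)}"

text \<open>Real polynomial functions in the variables \<open>x\<^sub>1, \<dots>, x\<^sub>n\<close>, generated in the same way as
  \<open>real_polynomial_function\<close> (which needs a normed space as its domain).\<close>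

inductive polynomial_in :: "nat \<Rightarrow> ((nat \<Rightarrow> real) \<Rightarrow> real) \<Rightarrow> bool" for n where
  const: "polynomial_in n (\<lambda>x. c)"
| var: "i \<in> {1..n} \<Longrightarrow> polynomial_in n (\<lambda>x. x i)"
| add: "polynomial_in n p \<Longrightarrow> polynomial_in n q \<Longrightarrow> polynomial_in n (\<lambda>x. p x + q x)"
| mult: "polynomial_in n p \<Longrightarrow> polynomial_in n q \<Longrightarrow> polynomial_in n (\<lambda>x. p x * q x)"

text \<open>The volume polynomial is pinned down by its values at positive arguments, since
  polynomial functions that agree on the positive orthant are equal.\<close>

definition volume_poly :: "nat \<Rightarrow> (nat \<Rightarrow> real) \<Rightarrow> real" where
  "volume_poly n = (THE p. polynomial_in n p \<and>
     (\<forall>x. (\<forall>i\<in>{1..n}. x i > 0) \<longrightarrow>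
        p x = measure (PiM {1..n} (\<lambda>_. lborel)) (Pi_polytope n x)))"

end

theory Submission
  imports Defs
begin

text \<open>Write \<open>X\<^sub>i = x\<^sub>1 + \<dots> + x\<^sub>i\<close>. Sending each entry \<open>v\<close> of an \<open>x\<close>-parking function to the index
  \<open>k\<close> of the block \<open>X\<^bsub>k-1\<^esub> < v \<le> X\<^sub>k\<close> containing it gives a parking function, and the fibre over
  \<open>a\<close> has \<open>x\<^bsub>a\<^sub>1\<^esub> \<cdots> x\<^bsub>a\<^sub>n\<^esub>\<close> elements. For the volume, \<open>U\<^sub>k = P\<^sub>k(x)\<close> and \<open>U\<^sub>k = k! V\<^sub>k(x)\<close> satisfy the
  same recursion \<open>c\<^sup>n = \<Sum>\<^bsub>k\<le>n\<^esub> (n choose k) U\<^sub>k (c - X\<^bsub>k+1\<^esub>)\<^bsup>n-k\<^esup>\<close> for \<open>c \<ge> X\<^sub>n\<close>: in the first case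
  one sorts the sequences in \<open>{1..c}\<^sup>n\<close> by the first index at which the parking condition fails, in
  the second one integrates \<open>(c - y\<^sub>1 - \<dots> - y\<^sub>n)\<^sup>m / m!\<close> over the polytope, last coordinate first.
  With \<open>c = X\<^sub>n\<close> the recursion determines both sequences and shows that they are polynomials.\<close>

section \<open>Parking conditions as counting conditions\<close>

text \<open>The positions of \<open>sort a\<close> holding values at most \<open>v\<close> form an
  initial segment. Counts replace sorted positions because they behave well under filtering,
  shuffling and blockwise maps.\<close>

lemma sorted_nth_le_iff:
  fixes a :: "nat list"
  assumes "i \<in> {1..length a}"
  shows "sort a ! (i - 1) \<le> v \<longleftrightarrow> i \<le> length (filter (\<lambda>k. k \<le> v) a)"
proof -
  let ?s = "sort a"
  let ?J = "{j. j < length ?s \<and> ?s ! j \<le> v}"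
  have len: "length (filter (\<lambda>k. k \<le> v) a) = card ?J"
  proof -
    have "length (filter (\<lambda>k. k \<le> v) a) = length (filter (\<lambda>k. k \<le> v) ?s)"
      by (simp add: filter_sort)
    then show ?thesis by (simp add: length_filter_conv_card)
  qed
  have mono: "?s ! j \<le> ?s ! l" if "j \<le> l" "l < length a" for j l
    using that by (simp add: sorted_nth_mono)
  show ?thesis
  proof
    assume "?s ! (i - 1) \<le> v"
    moreover have "?s ! j \<le> ?s ! (i - 1)" if "j < i" for j
      using assms that by (intro mono) auto
    ultimately have "{..<i} \<subseteq> ?J"
      using assms by (auto intro: le_trans)
    from card_mono[OF _ this] show "i \<le> length (filter (\<lambda>k. k \<le> v) a)"
      by (simp add: len)
  next
    assume le: "i \<le> length (filter (\<lambda>k. k \<le> v) a)"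
    show "?s ! (i - 1) \<le> v"
    proof (rule ccontr)
      assume "\<not> ?s ! (i - 1) \<le> v"
      then have "j < i - 1" if "j \<in> ?J" for j
        using mono[of "i - 1" j] that by (cases "i - 1 \<le> j") auto
      then have "?J \<subseteq> {..<i - 1}" by blast
      from card_mono[OF _ this] have "card ?J \<le> i - 1" by simp
      moreover have "i \<ge> 1" using assms by simp
      ultimately show False using le len by linarith
    qed
  qed
qed

lemma x_park_iff:
  "a \<in> x_park n x \<longleftrightarrow> length a = n \<and> (\<forall>k\<in>set a. k > 0) \<and>
     (\<forall>i\<in>{1..n}. i \<le> length (filter (\<lambda>k. k \<le> (\<Sum>j=1..i. x j)) a))"
  unfolding x_park_def by (auto simp: sorted_nth_le_iff simp del: One_nat_def)

lemma park_eq_x_park: "park n = x_park n (\<lambda>_. 1)"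
  by (simp add: park_def x_park_def)

lemma mono_partial_sum:
  fixes x :: "nat \<Rightarrow> nat"
  shows "i \<le> l \<Longrightarrow> (\<Sum>j=1..i. x j) \<le> (\<Sum>j=1..l. x j)"
  by (rule sum_mono2) auto

text \<open>The condition at index \<open>n\<close> already says that all \<open>n\<close> entries
  are at most the full sum.\<close>

lemma x_park_le:
  assumes "a \<in> x_park n x" "v \<in> set a"
  shows "v \<le> (\<Sum>j=1..n. x j)"
proof -
  have "n \<ge> 1" using assms by (cases n) (auto simp: x_park_iff)
  then have "n \<le> length (filter (\<lambda>k. k \<le> (\<Sum>j=1..n. x j)) a)" "length a = n"
    using assms(1) unfolding x_park_iff by auto
  then have "length (filter (\<lambda>k. k \<le> (\<Sum>j=1..n. x j)) a) = length a"
    using length_filter_le le_antisym by metis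
  then show ?thesis using assms(2) by (metis length_filter_less less_irrefl)
qed

lemma finite_x_park: "finite (x_park n x)"
proof (rule finite_subset)
  show "x_park n x \<subseteq> {a. set a \<subseteq> {..\<Sum>j=1..n. x j} \<and> length a = n}"
    using x_park_le by (auto simp: x_park_iff)
qed (simp add: finite_lists_length_eq)

section \<open>Fibres of the block map onto ordinary parking functions\<close>

text \<open>Taking the blocks for \<open>S\<close>, this set becomes the fibre over
  \<open>a\<close>, so that its size is a product.\<close>

lemma in_listset_map_iff:
  "b \<in> listset (map S a) \<longleftrightarrow> list_all2 (\<lambda>v k. v \<in> S k) b a"
  by (induction a arbitrary: b) (auto simp: set_Cons_def list_all2_Cons2)

lemma finite_card_listset:
  assumes "\<forall>A\<in>set As. finite A"
  shows "finite (listset As) \<and> card (listset As) = (\<Prod>A\<leftarrow>As. card A)"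
  using assms
proof (induction As)
  case (Cons A As)
  have eq: "listset (A # As) = (\<lambda>(v, vs). v # vs) ` (A \<times> listset As)"
    by (auto simp: set_Cons_def)
  have "inj_on (\<lambda>(v, vs). v # vs) (A \<times> listset As)" by (auto simp: inj_on_def)
  then show ?case
    using Cons unfolding eq by (simp add: card_image card_cartesian_product)
qed simp

lemma card_x_park_eq_sum:
  "card (x_park n x) = (\<Sum>a\<in>park n. \<Prod>k\<leftarrow>a. x k)"
proof -
  define X where "X i = (\<Sum>j=1..i. x j)" for i
  have mono: "X i \<le> X l" if "i \<le> l" for i l
    using mono_partial_sum[OF that] by (simp add: X_def)
  define block where "block k = {X (k - 1)<..X k}" for k
  \<comment> \<open>Each \<open>X i\<close> is a block boundary and never cuts through a
    block.\<close>
  have block_iff: "v \<le> X i \<longleftrightarrow> k \<le> i" if "v \<in> block k" "k > 0" for v k i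
    using that mono[of k i] mono[of i "k - 1"] by (force simp: block_def)
  have card_block: "card (block k) = x k" if "k > 0" for k
    using that by (cases k) (auto simp: block_def X_def)
  have ones: "(\<Sum>j=1..i. 1) = i" for i :: nat by simp
  \<comment> \<open>By \<open>block_iff\<close> the counts of \<open>b\<close> at \<open>X i\<close>
    and of \<open>a\<close> at \<open>i\<close> coincide.\<close>
  have same: "b \<in> x_park n x \<longleftrightarrow> a \<in> park n"
    if "list_all2 (\<lambda>v k. v \<in> block k) b a" "\<forall>k\<in>set a. k > 0" for a b
  proof -
    have "length (filter (\<lambda>v. v \<le> X i) b) = length (filter (\<lambda>k. k \<le> i) a)" for i
      using that by (induction rule: list_all2_induct) (auto simp: block_iff)
    moreover have "\<forall>v\<in>set b. v > 0"
      using that(1) by (induction rule: list_all2_induct) (auto simp: block_def)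
    ultimately show ?thesis
      using that list_all2_lengthD[OF that(1)]
      by (simp add: park_eq_x_park x_park_iff X_def ones del: One_nat_def)
  qed
  have pos: "\<forall>k\<in>set a. k > 0" if "a \<in> park n" for a
    using that by (simp add: park_def)
  have ex: "\<exists>a\<in>park n. b \<in> listset (map block a)" if b: "b \<in> x_park n x" for b
  proof -
    \<comment> \<open>Minimality skips the empty blocks, those with \<open>x k = 0\<close>;
      positivity of \<open>f v\<close> comes from \<open>X 0 = 0 < v\<close>.\<close>
    define f where "f v = (LEAST k. v \<le> X k)" for v
    have f: "v \<in> block (f v) \<and> f v > 0" if "v \<in> set b" for v
    proof -
      have "v \<le> X n" using x_park_le[OF b that] by (simp add: X_def)
      then have le: "v \<le> X (f v)" unfolding f_def by (rule LeastI)
      have "v > 0" using b that by (simp add: x_park_iff)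
      with le have "f v > 0" by (metis X_def atLeastatMost_empty gr0I le_zero_eq less_irrefl
            sum.empty zero_less_one)
      then have "\<not> v \<le> X (f v - 1)"
        unfolding f_def by (intro not_less_Least) simp
      with le \<open>f v > 0\<close> show ?thesis by (simp add: block_def)
    qed
    then have *: "list_all2 (\<lambda>v k. v \<in> block k) b (map f b)"
      by (auto simp: list.rel_map intro!: list.rel_refl_strong)
    then show ?thesis
      using same[OF *] b f by (auto simp: in_listset_map_iff)
  qed
  have UN: "x_park n x = (\<Union>a\<in>park n. listset (map block a))"
    using ex same pos by (force simp: in_listset_map_iff)
  have disj: "listset (map block a) \<inter> listset (map block a') = {}"
    if "a \<in> park n" "a' \<in> park n" "a \<noteq> a'" for a a'
  proof (rule ccontr)
    assume "\<not> ?thesis"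
    then obtain b where b: "list_all2 (\<lambda>v k. v \<in> block k) b a" "list_all2 (\<lambda>v k. v \<in> block k) b a'"
      by (auto simp: in_listset_map_iff)
    \<comment> \<open>If one value lies in two blocks, \<open>block_iff\<close> gives both
      inequalities between their indices.\<close>
    have "a ! i = a' ! i" if "i < length b" for i
    proof -
      have "b ! i \<in> block (a ! i)" "b ! i \<in> block (a' ! i)" "a ! i > 0" "a' ! i > 0"
        using b that pos \<open>a \<in> park n\<close> \<open>a' \<in> park n\<close> by (auto simp: list_all2_conv_all_nth)
      then show ?thesis by (metis block_iff le_antisym order_refl)
    qed
    with b have "a = a'" by (auto simp: list_all2_conv_all_nth intro: nth_equalityI)
    with that show False by simp
  qed
  have fin: "\<forall>A\<in>set (map block a). finite A" for a by (auto simp: block_def)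
  have "card (x_park n x) = (\<Sum>a\<in>park n. card (listset (map block a)))"
    unfolding UN using finite_card_listset[OF fin] disj
    by (intro card_UN_disjoint) (auto simp: park_eq_x_park finite_x_park)
  also have "\<dots> = (\<Sum>a\<in>park n. \<Prod>k\<leftarrow>a. x k)"
  proof (rule sum.cong)
    fix a assume "a \<in> park n"
    then have "map (card \<circ> block) a = map x a" using pos card_block by auto
    then show "card (listset (map block a)) = (\<Prod>k\<leftarrow>a. x k)"
      using finite_card_listset[OF fin, of a] by (simp del: map_eq_conv)
  qed simp
  finally show ?thesis .
qed

section \<open>The recursion for the number of parking functions\<close>

text \<open>For \<open>b\<close> in \<open>{1..c}\<close> to the power \<open>n\<close>, take the
  least \<open>k\<close> with at most \<open>k\<close> entries below or at \<open>X (k + 1)\<close>.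
  Those entries number exactly \<open>k\<close> and form a parking function, the others lie in
  \<open>{X (k + 1)<..c}\<close>, and the binomial coefficient counts the interleavings. At
  \<open>k = n\<close> the exponent is 0, so truncation of the difference does no harm.\<close>

lemma card_x_park_recursion:
  assumes c: "(\<Sum>j=1..n. x j) \<le> c"
  shows "c ^ n = (\<Sum>k\<le>n. (n choose k) * card (x_park k x) * (c - (\<Sum>j=1..k + 1. x j)) ^ (n - k))"
proof -
  define X where "X i = (\<Sum>j=1..i. x j)" for i
  have mono: "X i \<le> X l" if "i \<le> l" for i l
    using mono_partial_sum[OF that] by (simp add: X_def)
  define N where "N b v = length (filter (\<lambda>k. k \<le> v) b)" for b :: "nat list" and v
  have N_mono: "N b v \<le> N b w" if "v \<le> w" for b v w
    using that unfolding N_def by (induction b) auto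
  have x_park: "a \<in> x_park k x \<longleftrightarrow> length a = k \<and> (\<forall>v\<in>set a. v > 0) \<and> (\<forall>i\<in>{1..k}. i \<le> N a (X i))"
    for a k by (simp add: x_park_iff X_def N_def)
  have x_le: "v \<le> X l" if "p \<in> x_park k x" "v \<in> set p" "k \<le> l" for k l p v
    using x_park_le[OF that(1,2)] mono[OF that(3)] by (simp add: X_def)
  define L where "L k = {q. set q \<subseteq> {X (k + 1)<..c} \<and> length q = n - k}" for k
  define T where "T = (SIGMA k:{..n}. x_park k x \<times> L k)"
  define Sh where "Sh t = (case t of (k, p, q) \<Rightarrow> shuffles p q)" for t :: "nat \<times> nat list \<times> nat list"
  \<comment> \<open>Once \<open>k\<close> is known, the threshold \<open>X (k + 1)\<close> recovers
    \<open>p\<close> and \<open>q\<close> from any shuffle, and the counts at \<open>X i\<close>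
    with \<open>i \<le> k\<close> see only \<open>p\<close>.\<close>
  have split: "filter (\<lambda>v. v \<le> X (k + 1)) b = p \<and> filter (\<lambda>v. \<not> v \<le> X (k + 1)) b = q \<and>
      (\<forall>i\<in>{1..k}. N b (X i) = N p (X i)) \<and> N b (X (k + 1)) = k"
    if "(k, p, q) \<in> T" "b \<in> shuffles p q" for k p q b
  proof -
    have pq: "p \<in> x_park k x" "q \<in> L k" using that(1) by (auto simp: T_def)
    have p: "\<forall>v\<in>set p. v \<le> X (k + 1)" using x_le[OF pq(1)] by simp
    have q: "\<forall>v\<in>set q. \<not> v \<le> X (k + 1)" using pq(2) by (auto simp: L_def)
    have lp: "length p = k" using pq(1) by (simp add: x_park)
    have fil: "filter P b \<in> shuffles (filter P p) (filter P q)" for P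
      using that(2) filter_shuffles[of P p q] by blast
    have fp: "filter (\<lambda>v. v \<le> X (k + 1)) b = p"
      using fil[of "\<lambda>v. v \<le> X (k + 1)"] p q by simp
    have fq: "filter (\<lambda>v. \<not> v \<le> X (k + 1)) b = q"
      using fil[of "\<lambda>v. \<not> v \<le> X (k + 1)"] p q by simp
    have "N b (X i) = N p (X i)" if "i \<in> {1..k}" for i
    proof -
      have "X i \<le> X (k + 1)" using that by (intro mono) simp
      then show ?thesis unfolding N_def fp[symmetric]
        by (auto intro!: arg_cong[of _ _ length] filter_cong)
    qed
    with fp fq lp show ?thesis by (auto simp: N_def)
  qed
  have disj: "Sh t \<inter> Sh t' = {}" if t: "t \<in> T" "t' \<in> T" "t \<noteq> t'" for t t'
  proof (rule ccontr)
    assume "Sh t \<inter> Sh t' \<noteq> {}"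
    moreover obtain k p q k' p' q' where tt: "t = (k, p, q)" "t' = (k', p', q')"
      by (metis prod_cases3)
    ultimately obtain b where b: "b \<in> shuffles p q" "b \<in> shuffles p' q'" by (auto simp: Sh_def)
    note s = split[OF t(1)[unfolded tt] b(1)] and s' = split[OF t(2)[unfolded tt] b(2)]
    have P: "\<forall>i\<in>{1..k}. i \<le> N p (X i)" "\<forall>i\<in>{1..k'}. i \<le> N p' (X i)"
      using t unfolding tt T_def by (auto simp: x_park)
    \<comment> \<open>Otherwise the parking condition of \<open>p'\<close> at \<open>k + 1\<close>
      gives \<open>k + 1\<close> entries of \<open>b\<close> up to \<open>X (k + 1)\<close>, where
      there are only \<open>k\<close>.\<close>
    have "\<not> k < k'"
    proof
      assume "k < k'"
      then have "k + 1 \<le> N b (X (k + 1))" using s' P(2) by (metis atLeastAtMost_iff le_add2 Suc_eq_plus1 Suc_leI)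
      then show False using s by simp
    qed
    moreover have "\<not> k' < k"
    proof
      assume "k' < k"
      then have "k' + 1 \<le> N b (X (k' + 1))" using s P(1) by (metis atLeastAtMost_iff le_add2 Suc_eq_plus1 Suc_leI)
      then show False using s' by simp
    qed
    ultimately have "k = k'" by simp
    with s s' t(3) tt show False by auto
  qed
  have UN: "{b. set b \<subseteq> {1..c} \<and> length b = n} = (\<Union>t\<in>T. Sh t)"
  proof (intro equalityI subsetI)
    fix b assume "b \<in> {b. set b \<subseteq> {1..c} \<and> length b = n}"
    then have b: "set b \<subseteq> {1..c}" "length b = n" by auto
    define k where "k = (LEAST k. N b (X (k + 1)) \<le> k)"
    \<comment> \<open>The least index exists because \<open>b\<close> has only \<open>n\<close>
      entries.\<close>
    have n: "N b (X (n + 1)) \<le> n" using b length_filter_le[of _ b] by (auto simp: N_def)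
    from LeastI[of "\<lambda>k. N b (X (k + 1)) \<le> k", OF n]
    have k: "N b (X (k + 1)) \<le> k" by (fold k_def)
    from Least_le[of "\<lambda>k. N b (X (k + 1)) \<le> k", OF n]
    have kn: "k \<le> n" by (fold k_def)
    have below: "i \<le> N b (X i)" if i: "i \<in> {1..k}" for i
    proof (cases i)
      case (Suc l)
      with i have "l < k" by simp
      then have "\<not> N b (X (l + 1)) \<le> l"
        unfolding k_def by (rule not_less_Least)
      with Suc show ?thesis by simp
    qed simp
    \<comment> \<open>Minimality of \<open>k\<close> gives the bound already at \<open>X k\<close>;
      hence the count at \<open>X (k + 1)\<close> is exactly \<open>k\<close>.\<close>
    have "k \<le> N b (X (k + 1))"
    proof (cases "k = 0")
      case False
      then have "k \<le> N b (X k)" by (intro below) simp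
      also have "\<dots> \<le> N b (X (k + 1))" by (intro N_mono mono) simp
      finally show ?thesis .
    qed simp
    with k have Nk: "N b (X (k + 1)) = k" by simp
    let ?p = "filter (\<lambda>v. v \<le> X (k + 1)) b" and ?q = "filter (\<lambda>v. \<not> v \<le> X (k + 1)) b"
    have "N ?p (X i) = N b (X i)" if "i \<in> {1..k}" for i
    proof -
      have "X i \<le> X (k + 1)" using that by (intro mono) simp
      then show ?thesis unfolding N_def
        by (auto intro!: arg_cong[of _ _ length] filter_cong)
    qed
    then have "\<forall>i\<in>{1..k}. i \<le> N ?p (X i)" using below by simp
    moreover have "\<forall>v\<in>set ?p. v > 0" using b(1) by force
    ultimately have "?p \<in> x_park k x" using Nk by (simp add: x_park N_def)
    moreover have "?q \<in> L k"
    proof -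
      have "length ?p + length ?q = n"
        using sum_length_filter_compl[of "\<lambda>v. v \<le> X (k + 1)" b] b(2) by simp
      moreover have "set ?q \<subseteq> {X (k + 1)<..c}" using b(1) by auto
      ultimately show ?thesis using Nk by (simp add: L_def N_def)
    qed
    moreover have "b \<in> shuffles ?p ?q" by (rule partition_in_shuffles)
    ultimately have "(k, ?p, ?q) \<in> T" "b \<in> Sh (k, ?p, ?q)"
      using kn by (simp_all only: T_def Sh_def mem_Sigma_iff atMost_iff prod.case)
    then show "b \<in> (\<Union>t\<in>T. Sh t)" by (rule UN_I)
  next
    fix b assume "b \<in> (\<Union>t\<in>T. Sh t)"
    then obtain k p q where t: "k \<le> n" "p \<in> x_park k x" "q \<in> L k" "b \<in> shuffles p q"
      by (auto simp: T_def Sh_def)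
    have "\<forall>v\<in>set p. v \<le> c"
      using x_le[OF t(2) _ t(1)] c by (auto simp: X_def intro: order_trans)
    moreover have "\<forall>v\<in>set p. v \<ge> 1" "length p = k"
      using t(2) by (auto simp: x_park Suc_le_eq)
    moreover have "set q \<subseteq> {1..c}" "length q = n - k"
      using t(3) by (auto simp: L_def)
    ultimately have "set p \<union> set q \<subseteq> {1..c}" "length p + length q = n"
      using t(1) by auto
    then show "b \<in> {b. set b \<subseteq> {1..c} \<and> length b = n}"
      by (simp add: set_shuffles[OF t(4)] length_shuffles[OF t(4)])
  qed
  have finL: "finite (L k)" and cardL: "card (L k) = (c - X (k + 1)) ^ (n - k)" for k
    by (simp_all add: L_def finite_lists_length_eq card_lists_length_eq)
  have finT: "finite T" by (auto simp: T_def finL finite_x_park)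
  have cardSh: "card (Sh t) = n choose fst t" if "t \<in> T" for t
  proof -
    obtain k p q where t: "t = (k, p, q)" by (metis prod_cases3)
    \<comment> \<open>Disjoint value sets make all interleavings distinct, so their number is a
      binomial coefficient.\<close>
    have "set p \<inter> set q = {}"
      using that x_le[of p k _ "k + 1"] by (force simp: t T_def L_def)
    from card_disjoint_shuffles[OF this] that show ?thesis
      by (auto simp: t T_def Sh_def L_def x_park)
  qed
  have "c ^ n = card {b. set b \<subseteq> {1..c} \<and> length b = n}"
    by (simp add: card_lists_length_eq)
  also have "\<dots> = (\<Sum>t\<in>T. card (Sh t))"
    unfolding UN using finT disj by (intro card_UN_disjoint) (auto simp: Sh_def)
  also have "\<dots> = (\<Sum>t\<in>T. n choose fst t)" using cardSh by simp
  also have "\<dots> = (\<Sum>k\<le>n. \<Sum>pq\<in>x_park k x \<times> L k. n choose k)"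
    unfolding T_def by (subst sum.Sigma) (auto simp: finL finite_x_park case_prod_beta)
  also have "\<dots> = (\<Sum>k\<le>n. (n choose k) * card (x_park k x) * (c - X (k + 1)) ^ (n - k))"
    by (simp add: card_cartesian_product cardL mult_ac)
  finally show ?thesis by (simp add: X_def)
qed

section \<open>The common solution of the recursions\<close>

text \<open>The recursion at \<open>c = X_n\<close>, solved for its term \<open>k = n\<close>. The
  result is the Goncarov polynomial with nodes \<open>-X_1, ..., -X_n\<close>, evaluated at
  0.\<close>

fun parking_poly :: "nat \<Rightarrow> (nat \<Rightarrow> real) \<Rightarrow> real" where
  "parking_poly n x = (\<Sum>j=1..n. x j) ^ n -
     (\<Sum>k<n. real (n choose k) * parking_poly k x * ((\<Sum>j=1..n. x j) - (\<Sum>j=1..k + 1. x j)) ^ (n - k))"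

declare parking_poly.simps [simp del]

text \<open>The term \<open>k = m\<close> has binomial coefficient 1 and exponent 0, so it equals
  \<open>U m\<close> and is determined by the earlier values.\<close>

lemma parking_poly_unique:
  assumes "\<And>m. m \<le> n \<Longrightarrow> (\<Sum>j=1..m. x j) ^ m =
    (\<Sum>k\<le>m. real (m choose k) * U k * ((\<Sum>j=1..m. x j) - (\<Sum>j=1..k + 1. x j)) ^ (m - k))"
  shows "U n = parking_poly n x"
proof -
  have "m \<le> n \<Longrightarrow> U m = parking_poly m x" for m
  proof (induction m rule: less_induct)
    case (less m)
    then show ?case
      using assms[OF less.prems] by (subst parking_poly.simps) (simp add: lessThan_Suc_atMost[symmetric])
  qed
  then show ?thesis by simp
qed

section \<open>Polynomial functions and their uniqueness\<close>

lemma polynomial_in_sum: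
  "(\<And>i. i \<in> I \<Longrightarrow> polynomial_in n (f i)) \<Longrightarrow> polynomial_in n (\<lambda>x. \<Sum>i\<in>I. f i x)"
  by (induction I rule: infinite_finite_induct) (auto intro: polynomial_in.intros)

lemma polynomial_in_power:
  "polynomial_in n p \<Longrightarrow> polynomial_in n (\<lambda>x. p x ^ k)"
  by (induction k) (auto intro: polynomial_in.intros)

lemma polynomial_in_diff:
  assumes "polynomial_in n p" "polynomial_in n q"
  shows "polynomial_in n (\<lambda>x. p x - q x)"
  using polynomial_in.add[OF assms(1) polynomial_in.mult[OF polynomial_in.const[of n "-1"] assms(2)]]
  by simp

text \<open>Since \<open>k < n\<close>, the partial sums up to \<open>k + 1\<close> involve only the
  first \<open>n\<close> variables.\<close>

lemma polynomial_in_parking_poly: "n \<le> m \<Longrightarrow> polynomial_in m (parking_poly n)"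
proof (induction n rule: less_induct)
  case (less n)
  have X: "polynomial_in m (\<lambda>x. \<Sum>j=1..k. x j)" if "k \<le> n" for k
    using that less.prems by (intro polynomial_in_sum polynomial_in.var) auto
  have "polynomial_in m (\<lambda>x. (\<Sum>j=1..n. x j) ^ n -
     (\<Sum>k<n. real (n choose k) * parking_poly k x * ((\<Sum>j=1..n. x j) - (\<Sum>j=1..k + 1. x j)) ^ (n - k)))"
    using less.prems
    by (intro polynomial_in_sum polynomial_in_diff polynomial_in_power polynomial_in.mult
        polynomial_in.const less.IH X) auto
  moreover have "parking_poly n = (\<lambda>x. (\<Sum>j=1..n. x j) ^ n -
     (\<Sum>k<n. real (n choose k) * parking_poly k x * ((\<Sum>j=1..n. x j) - (\<Sum>j=1..k + 1. x j)) ^ (n - k)))"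
    by (rule ext, rule parking_poly.simps)
  ultimately show ?case by simp
qed

text \<open>Reduces uniqueness in several variables to the finiteness of the roots of a univariate
  polynomial.\<close>

lemma polynomial_in_line:
  "polynomial_in n p \<Longrightarrow> \<exists>r. \<forall>t. p (\<lambda>i. a i + t * b i) = poly r t"
proof (induction rule: polynomial_in.induct)
  case (const c)
  then show ?case by (intro exI[of _ "[:c:]"]) simp
next
  case (var i)
  then show ?case by (intro exI[of _ "[:a i, b i:]"]) simp
next
  case (add p q)
  then obtain r s where "\<forall>t. p (\<lambda>i. a i + t * b i) = poly r t" "\<forall>t. q (\<lambda>i. a i + t * b i) = poly s t"
    by blast
  then show ?case by (intro exI[of _ "r + s"]) simp
next
  case (mult p q)
  then obtain r s where "\<forall>t. p (\<lambda>i. a i + t * b i) = poly r t" "\<forall>t. q (\<lambda>i. a i + t * b i) = poly s t"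
    by blast
  then show ?case by (intro exI[of _ "r * s"]) simp
qed

lemma polynomial_in_eqI:
  assumes "polynomial_in n p" "polynomial_in n q"
    and eq: "\<And>x. (\<forall>i\<in>{1..n}. x i > 0) \<Longrightarrow> p x = q x"
  shows "p = q"
proof
  fix x :: "nat \<Rightarrow> real"
  \<comment> \<open>A direction with all entries at least 1 and \<open>x i + b i > 0\<close>: the
    ray from \<open>x\<close> is in the positive orthant for all \<open>t \<ge> 1\<close>, giving
    infinitely many roots, and \<open>t = 0\<close> returns to \<open>x\<close>.\<close>
  define b where "b i = 1 + \<bar>x i\<bar> - x i" for i
  obtain r where r: "\<And>t. p (\<lambda>i. x i + t * b i) - q (\<lambda>i. x i + t * b i) = poly r t"
    using polynomial_in_line[OF polynomial_in_diff[OF assms(1,2)], of x b] by blast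
  have "poly r t = 0" if "t \<ge> 1" for t
  proof -
    have "x i + t * b i > 0" for i
    proof -
      have "b i * 1 \<le> b i * t" using that by (intro mult_left_mono) (auto simp: b_def)
      then show ?thesis by (simp add: b_def mult.commute[of t])
    qed
    then show ?thesis using eq[of "\<lambda>i. x i + t * b i"] r[of t] by simp
  qed
  then have "{1..} \<subseteq> {t. poly r t = 0}" by auto
  then have "r = 0"
    using poly_roots_finite[of r] infinite_Ici[of "1::real"] finite_subset by blast
  then show "p x = q x" using r[of 0] by simp
qed

section \<open>Volume of the polytope by iterated integration\<close>

abbreviation lborel_upto :: "nat \<Rightarrow> (nat \<Rightarrow> real) measure" where
  "lborel_upto n \<equiv> PiM {1..n} (\<lambda>_. lborel)"

lemma Pi_polytope_measurable: "Pi_polytope n x \<in> sets (lborel_upto n)"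
proof -
  have "Pi_polytope n x = {y \<in> space (lborel_upto n).
     \<forall>i\<in>{1..n}. 0 \<le> y i \<and> (\<Sum>j=1..i. y j) \<le> (\<Sum>j=1..i. x j)}"
    by (auto simp: Pi_polytope_def space_PiM PiE_def)
  also have "\<dots> \<in> sets (lborel_upto n)"
  proof -
    have [measurable]: "(\<lambda>y. \<Sum>j=1..i. y j) \<in> borel_measurable (lborel_upto n)" if "i \<in> {1..n}" for i
      using that by (intro borel_measurable_sum) (auto intro!: measurable_PiM_component_rev)
    have [measurable]: "(\<lambda>y. y i) \<in> borel_measurable (lborel_upto n)" if "i \<in> {1..n}" for i
      using that by (auto intro!: measurable_PiM_component_rev)
    show ?thesis by measurable
  qed
  finally show ?thesis .
qed

text \<open>At \<open>m = 0\<close> this is the volume. Dividing by \<open>fact m\<close> makes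
  integration over the last coordinate raise \<open>m\<close> by one without a constant
  factor.\<close>

definition trunc_moment :: "(nat \<Rightarrow> real) \<Rightarrow> real \<Rightarrow> nat \<Rightarrow> nat \<Rightarrow> ennreal" where
  "trunc_moment x c n m =
    (\<integral>\<^sup>+y. ennreal ((c - (\<Sum>j=1..n. y j)) ^ m / fact m) * indicator (Pi_polytope n x) y \<partial>lborel_upto n)"

lemma Pi_polytope_Suc:
  assumes "y \<in> space (lborel_upto n)"
  shows "indicator (Pi_polytope (Suc n) x) (y(Suc n := t)) = (indicator (Pi_polytope n x) y *
     indicator {0..(\<Sum>j=1..Suc n. x j) - (\<Sum>j=1..n. y j)} t :: ennreal)"
proof -
  have "(\<Sum>j=1..i. (y(Suc n := t)) j) = (\<Sum>j=1..i. y j)" if "i \<le> n" for i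
    using that by (intro sum.cong) auto
  moreover from this have "(\<Sum>j=1..Suc n. (y(Suc n := t)) j) = (\<Sum>j=1..n. y j) + t"
    by simp
  moreover have "y(Suc n := t) \<in> extensional {1..Suc n}" "y \<in> extensional {1..n}"
    using assms by (auto simp: space_PiM PiE_def extensional_def)
  moreover have "{1..Suc n} = insert (Suc n) {1..n}" by auto
  ultimately have "y(Suc n := t) \<in> Pi_polytope (Suc n) x \<longleftrightarrow>
      y \<in> Pi_polytope n x \<and> t \<in> {0..(\<Sum>j=1..Suc n. x j) - (\<Sum>j=1..n. y j)}"
    unfolding Pi_polytope_def by (auto simp del: sum.cl_ivl_Suc)
  then show ?thesis by (auto simp: indicator_def)
qed

text \<open>For fixed \<open>y\<close> with sum \<open>s\<close>, the last coordinate runs over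
  \<open>{0..X - s}\<close>. The antiderivative at the upper end gives a value independent of
  \<open>y\<close>, hence a multiple of the lower-dimensional volume. That term is added on the
  right to avoid subtraction in \<open>ennreal\<close>.\<close>

lemma trunc_moment_Suc:
  assumes pos: "\<And>i. i \<in> {1..Suc n} \<Longrightarrow> x i > 0" and c: "(\<Sum>j=1..Suc n. x j) \<le> c"
  shows "trunc_moment x c n (Suc m) = trunc_moment x c (Suc n) m +
    ennreal ((c - (\<Sum>j=1..Suc n. x j)) ^ Suc m / fact (Suc m)) * emeasure (lborel_upto n) (Pi_polytope n x)"
proof -
  interpret product_sigma_finite "\<lambda>_::nat. lborel::real measure" ..
  define X where "X = (\<Sum>j=1..Suc n. x j)"
  define e where "e = (c - X) ^ Suc m / fact (Suc m)"
  have e: "e \<ge> 0" using c by (simp add: e_def X_def)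
  have ins: "{1..Suc n} = insert (Suc n) {1..n}" by auto
  have meas: "(\<lambda>y. ennreal ((c - (\<Sum>j=1..k. y j)) ^ l / fact l) * indicator (Pi_polytope k x) y)
      \<in> borel_measurable (lborel_upto k)" for k l
  proof -
    have [measurable]: "(\<lambda>y. \<Sum>j=1..k. y j) \<in> borel_measurable (lborel_upto k)"
      by (intro borel_measurable_sum) (auto intro!: measurable_PiM_component_rev)
    note Pi_polytope_measurable[measurable]
    show ?thesis by measurable
  qed
  have inner: "(\<integral>\<^sup>+t. ennreal ((c - (\<Sum>j=1..Suc n. (y(Suc n := t)) j)) ^ m / fact m) *
        indicator (Pi_polytope (Suc n) x) (y(Suc n := t)) \<partial>lborel) + ennreal e * indicator (Pi_polytope n x) y
      = ennreal ((c - (\<Sum>j=1..n. y j)) ^ Suc m / fact (Suc m)) * indicator (Pi_polytope n x) y"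
    if y: "y \<in> space (lborel_upto n)" for y
  proof (cases "y \<in> Pi_polytope n x")
    case False
    then show ?thesis by (simp only: Pi_polytope_Suc[OF y]) simp
  next
    case True
    define s where "s = (\<Sum>j=1..n. y j)"
    have "s \<le> X"
    proof (cases "n = 0")
      case False
      then have "s \<le> (\<Sum>j=1..n. x j)" using True by (auto simp: Pi_polytope_def s_def)
      then show ?thesis using pos[of "Suc n"] by (simp add: X_def)
    qed (use pos[of 1] in \<open>simp add: s_def X_def\<close>)
    define F where "F t = - ((c - s - t) ^ Suc m) / fact (Suc m)" for t
    have sum: "(\<Sum>j=1..Suc n. (y(Suc n := t)) j) = s + t" for t
    proof -
      have "(\<Sum>j=1..n. (y(Suc n := t)) j) = s" unfolding s_def by (intro sum.cong) auto
      then show ?thesis by simp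
    qed
    have deriv: "DERIV F t :> (c - s - t) ^ m / fact m" for t
    proof -
      have "DERIV F t :> - (real (Suc m) * (c - s - t) ^ m * (-1)) / fact (Suc m)"
        unfolding F_def by (rule derivative_eq_intros refl | simp)+
      then show ?thesis by (simp add: field_simps del: of_nat_Suc)
    qed
    have "(\<integral>\<^sup>+t. ennreal ((c - s - t) ^ m / fact m) * indicator {0..X - s} t \<partial>lborel) = ennreal (F (X - s) - F 0)"
    proof (rule nn_integral_FTC_Icc)
      show "0 \<le> (c - s - t) ^ m / fact m" if "t \<in> {0..X - s}" for t
        using that c unfolding X_def[symmetric] by simp
    qed (use deriv \<open>s \<le> X\<close> in \<open>auto intro: has_field_derivative_at_within\<close>)
    moreover have "ennreal (F (X - s) - F 0) + ennreal e = ennreal ((c - s) ^ Suc m / fact (Suc m))"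
    proof -
      have "F (X - s) = - e" "F 0 = - ((c - s) ^ Suc m / fact (Suc m))" by (simp_all add: F_def e_def)
      \<comment> \<open>Makes \<open>F (X - s) - F 0\<close> nonnegative, so that
        \<open>ennreal\<close> does not truncate it.\<close>
      moreover have "e \<le> (c - s) ^ Suc m / fact (Suc m)"
        unfolding e_def using \<open>s \<le> X\<close> c by (intro divide_right_mono power_mono) (auto simp: X_def)
      ultimately show ?thesis using e by (simp flip: ennreal_plus)
    qed
    ultimately show ?thesis
      using True by (simp only: Pi_polytope_Suc[OF y] sum X_def[symmetric] s_def[symmetric])
        (simp add: diff_diff_eq)
  qed
  have step: "trunc_moment x c (Suc n) m = (\<integral>\<^sup>+y. \<integral>\<^sup>+t. ennreal ((c - (\<Sum>j=1..Suc n. (y(Suc n := t)) j)) ^ m / fact m) *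
        indicator (Pi_polytope (Suc n) x) (y(Suc n := t)) \<partial>lborel \<partial>lborel_upto n)"
    unfolding trunc_moment_def using meas[of "Suc n" m] unfolding ins
    by (subst product_nn_integral_insert) auto
  have "trunc_moment x c (Suc n) m + ennreal e * emeasure (lborel_upto n) (Pi_polytope n x) =
      (\<integral>\<^sup>+y. (\<integral>\<^sup>+t. ennreal ((c - (\<Sum>j=1..Suc n. (y(Suc n := t)) j)) ^ m / fact m) *
        indicator (Pi_polytope (Suc n) x) (y(Suc n := t)) \<partial>lborel) +
        ennreal e * indicator (Pi_polytope n x) y \<partial>lborel_upto n)"
  unfolding step
  proof (subst nn_integral_add)
    note Pi_polytope_measurable[measurable]
    show "(\<lambda>y. ennreal e * indicator (Pi_polytope n x) y) \<in> borel_measurable (lborel_upto n)"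
      by measurable
    \<comment> \<open>Joint measurability in \<open>(y, t)\<close> yields measurability of the inner
      integral in \<open>y\<close>.\<close>
    have upd: "(\<lambda>(y, t). y(Suc n := t)) \<in> lborel_upto n \<Otimes>\<^sub>M lborel \<rightarrow>\<^sub>M lborel_upto (Suc n)"
      unfolding ins using measurable_add_dim[of "Suc n" "{1..n}" "\<lambda>_. lborel"] by simp
    from measurable_compose[OF upd meas[of "Suc n" m]]
    show "(\<lambda>y. \<integral>\<^sup>+t. ennreal ((c - (\<Sum>j=1..Suc n. (y(Suc n := t)) j)) ^ m / fact m) *
        indicator (Pi_polytope (Suc n) x) (y(Suc n := t)) \<partial>lborel) \<in> borel_measurable (lborel_upto n)"
      by (intro lborel.borel_measurable_nn_integral) (simp only: case_prod_beta')
  qed (simp only: nn_integral_cmult_indicator[OF Pi_polytope_measurable])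
  also have "\<dots> = trunc_moment x c n (Suc m)"
    unfolding trunc_moment_def by (rule nn_integral_cong) (simp only: inner)
  finally show ?thesis by (simp add: e_def X_def)
qed

lemma trunc_moment_0: "c \<ge> 0 \<Longrightarrow> trunc_moment x c 0 m = ennreal (c ^ m / fact m)"
  by (simp add: trunc_moment_def Pi_polytope_def PiM_empty nn_integral_count_space_finite)

text \<open>Iterates \<open>trunc_moment_Suc\<close> down to dimension 0; each step lowers
  \<open>n\<close>, raises \<open>m\<close> and leaves one volume term, so the induction must vary
  \<open>m\<close>.\<close>

lemma trunc_moment_sum:
  assumes pos: "\<And>i. i \<in> {1..n} \<Longrightarrow> x i > 0" and c: "(\<Sum>j=1..n. x j) \<le> c"
  shows "ennreal (c ^ (n + m) / fact (n + m)) = trunc_moment x c n m +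
    (\<Sum>k<n. ennreal ((c - (\<Sum>j=1..k + 1. x j)) ^ (n + m - k) / fact (n + m - k)) *
       emeasure (lborel_upto k) (Pi_polytope k x))"
  using assms
proof (induction n arbitrary: m)
  case 0
  then show ?case by (simp add: trunc_moment_0)
next
  case (Suc n)
  have "(\<Sum>j=1..n. x j) \<le> c" using Suc.prems(1)[of "Suc n"] Suc.prems(2) by simp
  from Suc.IH[OF _ this, of "Suc m"] trunc_moment_Suc[OF Suc.prems, of m] Suc.prems(1)
  show ?case by (simp add: add_ac Suc_diff_le)
qed

text \<open>The case \<open>m = 0\<close> of \<open>trunc_moment_sum\<close>, multiplied by
  \<open>fact n\<close> and moved from \<open>ennreal\<close> to the reals.\<close>

lemma volume_recursion:
  assumes pos: "\<And>i. i \<in> {1..n} \<Longrightarrow> x i > 0" and c: "(\<Sum>j=1..n. x j) \<le> c"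
  shows "c ^ n = (\<Sum>k\<le>n. real (n choose k) * (fact k * measure (lborel_upto k) (Pi_polytope k x)) *
      (c - (\<Sum>j=1..k + 1. x j)) ^ (n - k))"
proof -
  define V where "V k = measure (lborel_upto k) (Pi_polytope k x)" for k
  \<comment> \<open>Finiteness comes from the same identity: in dimension \<open>k\<close> it bounds
    the volume by \<open>c ^ k / fact k\<close>.\<close>
  have fin: "emeasure (lborel_upto k) (Pi_polytope k x) \<noteq> \<infinity>" if "k \<le> n" for k
  proof -
    have "(\<Sum>j=1..k. x j) \<le> (\<Sum>j=1..n. x j)"
      using that pos by (intro sum_mono2) (auto intro: less_imp_le)
    with that c pos have "trunc_moment x c k 0 \<le> ennreal (c ^ k / fact k)"
      using trunc_moment_sum[of k x c 0] by (auto simp: order_trans)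
    then have "trunc_moment x c k 0 < \<infinity>" by (auto simp: top.not_eq_extremum intro: le_less_trans)
    then show ?thesis by (simp add: trunc_moment_def Pi_polytope_measurable del: One_nat_def)
  qed
  have em: "emeasure (lborel_upto k) (Pi_polytope k x) = ennreal (V k)" if "k \<le> n" for k
    unfolding V_def using fin[OF that] by (intro emeasure_eq_ennreal_measure) simp
  have V0: "V k \<ge> 0" for k by (simp add: V_def)
  define w where "w k = (c - (\<Sum>j=1..k + 1. x j)) ^ (n - k) / fact (n - k)" for k
  \<comment> \<open>At \<open>k = n\<close> the base involves the unconstrained
    \<open>x (n + 1)\<close>, but the exponent is 0 and \<open>w n = 1\<close>.\<close>
  have w0: "w k \<ge> 0" if "k < n" for k
  proof -
    have "(\<Sum>j=1..k + 1. x j) \<le> (\<Sum>j=1..n. x j)"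
      using that pos by (intro sum_mono2) (auto intro: less_imp_le)
    with c show ?thesis by (simp add: w_def)
  qed
  have c0: "c \<ge> 0" using sum_nonneg[of "{1..n}" x] pos c by (force intro: less_imp_le)
  have "ennreal (c ^ n / fact n) = ennreal (V n) + (\<Sum>k<n. ennreal (w k) * ennreal (V k))"
    using trunc_moment_sum[OF assms, of 0] em
    by (simp add: trunc_moment_def Pi_polytope_measurable w_def del: One_nat_def sum.cl_ivl_Suc)
  also have "\<dots> = ennreal (V n + (\<Sum>k<n. w k * V k))"
  proof -
    have "ennreal (\<Sum>k<n. w k * V k) = (\<Sum>k<n. ennreal (w k * V k))"
      using w0 V0 by (intro sum_ennreal[symmetric]) auto
    also have "\<dots> = (\<Sum>k<n. ennreal (w k) * ennreal (V k))"
      using w0 V0 by (intro sum.cong) (auto simp: ennreal_mult)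
    finally show ?thesis
      using w0 V0 by (subst ennreal_plus) (auto intro!: sum_nonneg)
  qed
  finally have "c ^ n / fact n = V n + (\<Sum>k<n. w k * V k)"
    using c0 V0 w0 by (subst (asm) ennreal_inj) (auto intro!: add_nonneg_nonneg sum_nonneg)
  also have "\<dots> = (\<Sum>k\<le>n. w k * V k)"
    by (simp add: w_def lessThan_Suc_atMost[symmetric])
  finally have "c ^ n = (\<Sum>k\<le>n. fact n * (w k * V k))"
    by (simp add: field_simps sum_distrib_left)
  also have "\<dots> = (\<Sum>k\<le>n. real (n choose k) * (fact k * V k) * (c - (\<Sum>j=1..k + 1. x j)) ^ (n - k))"
    by (intro sum.cong) (simp_all add: w_def binomial_fact)
  finally show "c ^ n = (\<Sum>k\<le>n. real (n choose k) * (fact k * measure (lborel_upto k) (Pi_polytope k x)) *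
      (c - (\<Sum>j=1..k + 1. x j)) ^ (n - k))" by (simp add: V_def)
qed

section \<open>Comparison of count and volume\<close>

lemma parking_poly_eq_volume:
  assumes pos: "\<And>i. i \<in> {1..n} \<Longrightarrow> x i > 0"
  shows "parking_poly n x = fact n * measure (lborel_upto n) (Pi_polytope n x)"
  using assms by (intro parking_poly_unique[symmetric] volume_recursion) auto

lemma parking_poly_eq_card:
  "parking_poly n (\<lambda>i. real (x i)) = real (card (x_park n x))"
proof (rule parking_poly_unique[symmetric])
  fix m :: nat
  \<comment> \<open>For \<open>k < m\<close> the natural subtraction is exact; for
    \<open>k = m\<close> it may truncate, but under the exponent 0.\<close>
  have diff: "real ((\<Sum>j=1..m. x j) - (\<Sum>j=1..k + 1. x j)) ^ (m - k) =
      ((\<Sum>j=1..m. real (x j)) - (\<Sum>j=1..k + 1. real (x j))) ^ (m - k)" if "k \<le> m" for k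
  proof (cases "k = m")
    case False
    then have "(\<Sum>j=1..k + 1. x j) \<le> (\<Sum>j=1..m. x j)"
      using that by (intro mono_partial_sum) simp
    then show ?thesis by (simp only: of_nat_diff of_nat_sum)
  qed simp
  have "(\<Sum>j=1..m. real (x j)) ^ m = real ((\<Sum>j=1..m. x j) ^ m)" by simp
  also have "\<dots> = (\<Sum>k\<le>m. real (m choose k) * real (card (x_park k x)) *
      real ((\<Sum>j=1..m. x j) - (\<Sum>j=1..k + 1. x j)) ^ (m - k))"
    by (subst card_x_park_recursion[OF order_refl])
      (simp only: of_nat_sum of_nat_mult of_nat_power)
  also have "\<dots> = (\<Sum>k\<le>m. real (m choose k) * real (card (x_park k x)) *
      ((\<Sum>j=1..m. real (x j)) - (\<Sum>j=1..k + 1. real (x j))) ^ (m - k))"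
    using diff by (intro sum.cong) auto
  finally show "(\<Sum>j=1..m. real (x j)) ^ m = (\<Sum>k\<le>m. real (m choose k) * real (card (x_park k x)) *
      ((\<Sum>j=1..m. real (x j)) - (\<Sum>j=1..k + 1. real (x j))) ^ (m - k))" .
qed

text \<open>Uniqueness by \<open>polynomial_in_eqI\<close> makes the description in
  \<open>volume_poly\<close> definite, so its value is also known where some \<open>x i\<close>
  vanish.\<close>

lemma volume_poly_eq: "volume_poly n = (\<lambda>x. parking_poly n x / fact n)"
  unfolding volume_poly_def
proof (rule the_equality, intro conjI allI impI)
  show "polynomial_in n (\<lambda>x. parking_poly n x / fact n)"
    using polynomial_in.mult[OF polynomial_in_parking_poly[OF order_refl] polynomial_in.const[of n "1 / fact n"]]
    by simp
  show eq: "parking_poly n x / fact n = measure (lborel_upto n) (Pi_polytope n x)"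
    if "\<forall>i\<in>{1..n}. x i > 0" for x
    using that by (subst parking_poly_eq_volume) auto
  show "p = (\<lambda>x. parking_poly n x / fact n)"
    if "polynomial_in n p \<and> (\<forall>x. (\<forall>i\<in>{1..n}. x i > 0) \<longrightarrow> p x = measure (lborel_upto n) (Pi_polytope n x))"
    for p
    using that eq \<open>polynomial_in n (\<lambda>x. parking_poly n x / fact n)\<close>
    by (intro polynomial_in_eqI[of n]) auto
qed

theorem theorem11:
  fixes n :: nat and x :: "nat \<Rightarrow> nat"
  assumes "n \<ge> 1"
  shows "card (x_park n x) = (\<Sum>a\<in>park n. \<Prod>k\<leftarrow>a. x k) \<and>
    real (\<Sum>a\<in>park n. \<Prod>k\<leftarrow>a. x k) = fact n * volume_poly n (\<lambda>i. real (x i))"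
  by (simp add: volume_poly_eq parking_poly_eq_card flip: card_x_park_eq_sum)

end
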